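(* Let $\Lambda$ be a finite, simply connected subset of $\mathbb{Z}^2$, let $q_\sigma,q_\tau>0$, and for each bond $b$ let $a_0(b),a_\sigma(b),a_\tau(b),a_{\sigma\tau}(b)\ge0$ with $a_0(b)+a_\sigma(b)+a_\tau(b)+a_{\sigma\tau}(b)=1$. For each dual bond $\hat b$ crossing $b$ define $$\hat a_0(\hat b)=C'a_{\sigma\tau}(b),\quad \hat a_\sigma(\hat b)=q_\tau C'a_\sigma(b),\quad \hat a_\tau(\hat b)=q_\sigma C'a_\tau(b),\quad \hat a_{\sigma\tau}(\hat b)=q_\sigma q_\tau C'a_0(b),$$ where $C'=C'(b)$ is given by $C'^{-1}=a_{\sigma\tau}(b)+q_\tau a_\sigma(b)+q_\sigma a_\tau(b)+q_\sigma q_\tau a_0(b)$, and let $\hat q_\sigma=q_\tau$, $\hat q_\tau=q_\sigma$. Then for every function $f$ of bond configurations $\underline n$, $$\nu^+_\Lambda(f\,|\,a_0,a_\sigma,a_\tau,a_{\sigma\tau},q_\sigma,q_\tau)=\nu^f_{\Lambda^*}(\hat f\,|\,\hat a_0,\hat a_\sigma,\hat a_\tau,\hat a_{\sigma\tau},\hat q_\sigma,\hat q_\tau),$$ where $\hat f(\hat{\underline n})=f(\underline n(\hat{\underline n}))$ and $\underline n\leftrightarrow\hat{\underline n}$ is the correspondence between configurations and dual configurations.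
   Context: **Lattices.** Bonds are unit segments joining nearest neighbours of $\mathbb{Z}^2$. The dual lattice is $\mathbb{Z}^2+(\tfrac12,\tfrac12)$; each bond $b$ of $\mathbb{Z}^2$ is crossed by a unique dual bond $\hat b$, and each $t\in\mathbb{Z}^2$ is the centre of a unique closed dual plaquette $p^*(t)$. $\Lambda\subset\mathbb{Z}^2$ is simply connected if $\bigcup_{t\in\Lambda}p^*(t)$ is a simply connected subset of $\mathbb{R}^2$. $\mathcal{B}^+(\Lambda)$ is the set of bonds with at least one endpoint in $\Lambda$. $\Lambda^*$ is the cell complex formed by the plaquettes $p^*(t)$, $t\in\Lambda$, the set $\mathcal{B}(\Lambda^* )$ of dual bonds on their boundaries, and the endpoints of these bonds as sites. (One has $\mathcal{B}(\Lambda^* )=\{\hat b:b\in\mathcal{B}^+(\Lambda)\}$.) **Configurations.** A configuration $\underline n$ assigns $n_b=(n_{\sigma,b},n_{\tau,b})\in\{0,1\}^2$ to every bond $b$ of $\mathbb{Z}^2$. Its dual $\hat{\underline n}$ is the configuration on bonds of the dual lattice given by $\hat n_{\sigma,\hat b}=1-n_{\tau,b}$, $\hat n_{\tau,\hat b}=1-n_{\sigma,b}$ (note the exchange of $\sigma$ and $\tau$). This is a bijection; $\underline n(\hat{\underline n})$ denotes its inverse. $\sigma$-clusters (resp. $\tau$-clusters) are the connected components, isolated sites included, of the graph on all sites whose edges are the bonds with $n_{\sigma,b}=1$ (resp. $n_{\tau,b}=1$); the same terminology is used on the dual lattice. **Measures.** For a finite set of bonds $\mathcal{B}$, $\lambda_{\mathcal{B}}(\underline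 n)$ is the product over $b\in\mathcal{B}$ of $a_0(b)$, $a_\sigma(b)$, $a_\tau(b)$ or $a_{\sigma\tau}(b)$ according to whether $n_b=(0,0),(1,0),(0,1)$ or $(1,1)$. - $\nu^+_\Lambda(\cdot|a_0,a_\sigma,a_\tau,a_{\sigma\tau},q_\sigma,q_\tau)$: probability measure on configurations with $n_b=(1,1)$ for all $b\notin\mathcal{B}^+(\Lambda)$, with probabilities proportional to $\lambda_{\mathcal{B}^+(\Lambda)}(\underline n)\,q_\sigma^{N_\sigma(\underline n|\Lambda)}q_\tau^{N_\tau(\underline n|\Lambda)}$, where $N_\sigma(\underline n|\Lambda)$ (resp. $N_\tau(\underline n|\Lambda)$) is the number of $\sigma$-clusters (resp. $\tau$-clusters) of $\underline n$ intersecting $\Lambda$. - $\nu^f_{\Lambda^*}(\cdot|\hat a_0,\hat a_\sigma,\hat a_\tau,\hat a_{\sigma\tau},\hat q_\sigma,\hat q_\tau)$: probability measure on dual-lattice configurations with value $(0,0)$ at every dual bond not in $\mathcal{B}(\Lambda^* )$, with probabilities proportional to $\hat\lambda_{\mathcal{B}(\Lambda^* )}(\hat{\underline n})\,\hat q_\sigma^{N_\sigma(\hat{\underline n}|\Lambda^* )}\hat q_\tau^{N_\tau(\hat{\underline n}|\Lambda^* )}$, where $\hat\lambda$ is defined as $\lambda$ with the $\hat a$'s and $N_\sigma(\hat{\underline n}|\Lambda^* )$ (resp. $N_\tau(\hat{\underline n}|\Lambda^* )$) is the number of $\sigma$-clusters (resp. $\tau$-clusters) of $\hat{\underline n}$ intersecting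 the set of sites of $\Lambda^*$. The expectation of $f$ under a measure $\nu$ is written $\nu(f)$.
   Formalization: In the wired measure, clusters are counted if they meet the endpoints of the bonds of B^+(Λ) (Λ with its outer boundary), not only Λ itself; with the literal count the claim fails already for Λ={0} unless the weights or q's are special. *)

theory Defs
  imports "HOL-Analysis.Analysis" "HOL-Probability.Probability"
begin

section \<open>The square lattice and its dual\<close>

text \<open>
  Sites of both lattices are indexed by pairs of integers: the index \<open>(i, j)\<close> stands for the
  point \<open>(i, j)\<close> of the lattice and for the point \<open>(i + 1/2, j + 1/2)\<close> of the dual lattice.
  In the same way \<open>Hor i j\<close> and \<open>Ver i j\<close> index the bonds of both lattices, so that
  clusters need to be defined only once.
\<close>

type_synonym site = "int \<times> int"

datatype bond = Hor int int | Ver int int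

fun endpoints :: "bond \<Rightarrow> site set" where
  "endpoints (Hor i j) = {(i, j), (i + 1, j)}"
| "endpoints (Ver i j) = {(i, j), (i, j + 1)}"

definition point :: "site \<Rightarrow> real \<times> real" where
  "point s = (real_of_int (fst s), real_of_int (snd s))"

definition dual_point :: "site \<Rightarrow> real \<times> real" where
  "dual_point s = (real_of_int (fst s) + 1/2, real_of_int (snd s) + 1/2)"

definition segment :: "bond \<Rightarrow> (real \<times> real) set" where
  "segment b = convex hull (point ` endpoints b)"

definition dual_segment :: "bond \<Rightarrow> (real \<times> real) set" where
  "dual_segment e = convex hull (dual_point ` endpoints e)"

definition plaquette :: "site \<Rightarrow> (real \<times> real) set" where
  "plaquette t = cbox (point t - (1/2, 1/2)) (point t + (1/2, 1/2))"

text \<open>The index of the dual bond crossing a bond; see \<open>crosses_iff\<close> below.\<close>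

fun dual_bond :: "bond \<Rightarrow> bond" where
  "dual_bond (Hor i j) = Ver i (j - 1)"
| "dual_bond (Ver i j) = Hor (i - 1) j"

definition simply_connected_sites :: "site set \<Rightarrow> bool" where
  "simply_connected_sites \<Lambda> \<longleftrightarrow> simply_connected (\<Union>t\<in>\<Lambda>. plaquette t)"

definition bonds_plus :: "site set \<Rightarrow> bond set" where
  "bonds_plus \<Lambda> = {b. endpoints b \<inter> \<Lambda> \<noteq> {}}"

definition bonds_star :: "site set \<Rightarrow> bond set" where
  "bonds_star \<Lambda> = {e. \<exists>t\<in>\<Lambda>. dual_segment e \<subseteq> frontier (plaquette t)}"

definition bond_sites :: "bond set \<Rightarrow> site set" where
  "bond_sites B = (\<Union>b\<in>B. endpoints b)"

section \<open>Configurations and clusters\<close>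

text \<open>
  The first component is the \<open>\<sigma>\<close>-value, the second the \<open>\<tau>\<close>-value;
  \<open>True\<close> stands for 1 and \<open>False\<close> for 0.
\<close>

type_synonym config = "bond \<Rightarrow> bool \<times> bool"

definition dual_config :: "config \<Rightarrow> config" where
  "dual_config n = (\<lambda>e. let b = inv dual_bond e in (\<not> snd (n b), \<not> fst (n b)))"

definition open_edges :: "(bond \<Rightarrow> bool) \<Rightarrow> (site \<times> site) set" where
  "open_edges \<omega> = {(x, y). \<exists>b. \<omega> b \<and> endpoints b = {x, y}}"

definition clusters :: "(bond \<Rightarrow> bool) \<Rightarrow> site set set" where
  "clusters \<omega> = UNIV // (open_edges \<omega>)\<^sup>*"

definition cluster_number :: "(bond \<Rightarrow> bool) \<Rightarrow> site set \<Rightarrow> nat" where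
  "cluster_number \<omega> S = card {C \<in> clusters \<omega>. C \<inter> S \<noteq> {}}"

definition N\<^sub>\<sigma> :: "config \<Rightarrow> site set \<Rightarrow> nat" where
  "N\<^sub>\<sigma> n S = cluster_number (\<lambda>b. fst (n b)) S"

definition N\<^sub>\<tau> :: "config \<Rightarrow> site set \<Rightarrow> nat" where
  "N\<^sub>\<tau> n S = cluster_number (\<lambda>b. snd (n b)) S"

section \<open>The measures\<close>

definition bond_weight ::
  "bond set \<Rightarrow> (bond \<Rightarrow> real) \<Rightarrow> (bond \<Rightarrow> real) \<Rightarrow> (bond \<Rightarrow> real) \<Rightarrow> (bond \<Rightarrow> real)
    \<Rightarrow> config \<Rightarrow> real" where
  "bond_weight B a\<^sub>0 a\<^sub>\<sigma> a\<^sub>\<tau> a\<^sub>\<sigma>\<^sub>\<tau> n =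
    (\<Prod>b\<in>B. if n b = (False, False) then a\<^sub>0 b
           else if n b = (True, False) then a\<^sub>\<sigma> b
           else if n b = (False, True) then a\<^sub>\<tau> b
           else a\<^sub>\<sigma>\<^sub>\<tau> b)"

definition configs_outside :: "bool \<times> bool \<Rightarrow> bond set \<Rightarrow> config set" where
  "configs_outside v B = {n. \<forall>b. b \<notin> B \<longrightarrow> n b = v}"

definition rc_weight ::
  "bond set \<Rightarrow> site set \<Rightarrow> (bond \<Rightarrow> real) \<Rightarrow> (bond \<Rightarrow> real) \<Rightarrow> (bond \<Rightarrow> real)
    \<Rightarrow> (bond \<Rightarrow> real) \<Rightarrow> real \<Rightarrow> real \<Rightarrow> config \<Rightarrow> real" where
  "rc_weight B S a\<^sub>0 a\<^sub>\<sigma> a\<^sub>\<tau> a\<^sub>\<sigma>\<^sub>\<tau> q\<^sub>\<sigma> q\<^sub>\<tau> n =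
    bond_weight B a\<^sub>0 a\<^sub>\<sigma> a\<^sub>\<tau> a\<^sub>\<sigma>\<^sub>\<tau> n * q\<^sub>\<sigma> ^ N\<^sub>\<sigma> n S * q\<^sub>\<tau> ^ N\<^sub>\<tau> n S"

text \<open>
  Configurations have the value \<open>v\<close> outside the finite set \<open>B\<close> of bonds, and the clusters
  that meet \<open>S\<close> are counted.
\<close>

definition rc_measure ::
  "bool \<times> bool \<Rightarrow> bond set \<Rightarrow> site set \<Rightarrow> (bond \<Rightarrow> real) \<Rightarrow> (bond \<Rightarrow> real)
    \<Rightarrow> (bond \<Rightarrow> real) \<Rightarrow> (bond \<Rightarrow> real) \<Rightarrow> real \<Rightarrow> real \<Rightarrow> config measure" where
  "rc_measure v B S a\<^sub>0 a\<^sub>\<sigma> a\<^sub>\<tau> a\<^sub>\<sigma>\<^sub>\<tau> q\<^sub>\<sigma> q\<^sub>\<tau> =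
    point_measure (configs_outside v B)
      (\<lambda>n. ennreal (rc_weight B S a\<^sub>0 a\<^sub>\<sigma> a\<^sub>\<tau> a\<^sub>\<sigma>\<^sub>\<tau> q\<^sub>\<sigma> q\<^sub>\<tau> n
            / (\<Sum>m\<in>configs_outside v B. rc_weight B S a\<^sub>0 a\<^sub>\<sigma> a\<^sub>\<tau> a\<^sub>\<sigma>\<^sub>\<tau> q\<^sub>\<sigma> q\<^sub>\<tau> m)))"

text \<open>
  In the wired measure clusters are counted on the sites of the bonds in \<open>bonds_plus \<Lambda>\<close>, that
  is, on \<open>\<Lambda>\<close> together with its outer boundary, which is the usual convention for wired
  random-cluster measures: the cluster of the wired exterior is counted once, whether or not it
  reaches into \<open>\<Lambda>\<close>. If only the clusters meeting \<open>\<Lambda>\<close> itself were counted, then for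
  \<open>\<Lambda> = {0}\<close> there would always be exactly one \<open>\<sigma>\<close>-cluster and one \<open>\<tau>\<close>-cluster, and
  the measure would be a product measure, whose dual in general is not the free measure on the
  four-cycle of dual bonds around 0.
\<close>

definition nu_plus ::
  "site set \<Rightarrow> (bond \<Rightarrow> real) \<Rightarrow> (bond \<Rightarrow> real) \<Rightarrow> (bond \<Rightarrow> real) \<Rightarrow> (bond \<Rightarrow> real)
    \<Rightarrow> real \<Rightarrow> real \<Rightarrow> config measure" where
  "nu_plus \<Lambda> = rc_measure (True, True) (bonds_plus \<Lambda>) (bond_sites (bonds_plus \<Lambda>))"

definition nu_free_star ::
  "site set \<Rightarrow> (bond \<Rightarrow> real) \<Rightarrow> (bond \<Rightarrow> real) \<Rightarrow> (bond \<Rightarrow> real) \<Rightarrow> (bond \<Rightarrow> real)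
    \<Rightarrow> real \<Rightarrow> real \<Rightarrow> config measure" where
  "nu_free_star \<Lambda> = rc_measure (False, False) (bonds_star \<Lambda>) (bond_sites (bonds_star \<Lambda>))"

section \<open>Consistency of the encoding\<close>

lemma bij_dual_bond: "bij dual_bond"
proof (rule bijI)
  show "inj dual_bond"
  proof (rule injI)
    fix x y show "dual_bond x = dual_bond y \<Longrightarrow> x = y" by (cases x; cases y) auto
  qed
  show "surj dual_bond"
  proof (rule surjI)
    fix e show "dual_bond (case e of Hor i j \<Rightarrow> Ver (i + 1) j | Ver i j \<Rightarrow> Hor i (j + 1)) = e"
      by (cases e) auto
  qed
qed

lemma dual_config_dual_bond [simp]:
  "dual_config n (dual_bond b) = (\<not> snd (n b), \<not> fst (n b))"
  using bij_dual_bond by (simp add: dual_config_def bij_is_inj)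

lemma bij_dual_config: "bij dual_config"
proof (rule bijI)
  show "inj dual_config"
  proof (rule injI)
    fix m n assume "dual_config m = dual_config n"
    then have "dual_config m (dual_bond b) = dual_config n (dual_bond b)" for b by simp
    then show "m = n" by (auto simp: fun_eq_iff prod_eq_iff)
  qed
  show "surj dual_config"
  proof (rule surjI)
    fix m
    show "dual_config (\<lambda>b. (\<not> snd (m (dual_bond b)), \<not> fst (m (dual_bond b)))) = m"
      using bij_dual_bond
      by (auto simp: dual_config_def fun_eq_iff Let_def bij_is_surj surj_f_inv_f)
  qed
qed

lemma segment_Hor: "segment (Hor i j) = {of_int i..of_int i + 1} \<times> {of_int j}"
proof -
  have "closed_segment (real_of_int i, real_of_int j) (of_int i + 1, of_int j)
      = {of_int i..of_int i + 1} \<times> {of_int j}" (is "?L = ?R")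
  proof (intro equalityI subsetI)
    fix p assume "p \<in> ?L"
    then show "p \<in> ?R" by (auto simp: in_segment algebra_simps)
  next
    fix p assume "p \<in> ?R"
    then show "p \<in> ?L"
      by (auto simp: in_segment algebra_simps intro!: exI[of _ "fst p - of_int i"])
  qed
  then show ?thesis by (simp add: segment_def point_def segment_convex_hull)
qed

lemma segment_Ver: "segment (Ver i j) = {of_int i} \<times> {of_int j..of_int j + 1}"
proof -
  have "closed_segment (real_of_int i, real_of_int j) (of_int i, of_int j + 1)
      = {of_int i} \<times> {of_int j..of_int j + 1}" (is "?L = ?R")
  proof (intro equalityI subsetI)
    fix p assume "p \<in> ?L"
    then show "p \<in> ?R" by (auto simp: in_segment algebra_simps)
  next
    fix p assume "p \<in> ?R"
    then show "p \<in> ?L"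
      by (auto simp: in_segment algebra_simps intro!: exI[of _ "snd p - of_int j"])
  qed
  then show ?thesis by (simp add: segment_def point_def segment_convex_hull)
qed

lemma dual_segment_eq: "dual_segment e = (\<lambda>p. (1/2, 1/2) + p) ` segment e"
proof -
  have "dual_point ` A = (\<lambda>p. (1/2, 1/2) + p) ` point ` A" for A
    by (simp add: image_image dual_point_def point_def add.commute)
  then show ?thesis
    unfolding dual_segment_def segment_def by (simp add: convex_hull_translation)
qed

lemma mem_dual_segment_iff: "p \<in> dual_segment e \<longleftrightarrow> p - (1/2, 1/2) \<in> segment e"
proof
  assume "p \<in> dual_segment e"
  then obtain x where "x \<in> segment e" "p = (1/2, 1/2) + x"
    unfolding dual_segment_eq by (rule imageE)
  then show "p - (1/2, 1/2) \<in> segment e"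
    by (simp only: add_diff_cancel_left')
next
  assume "p - (1/2, 1/2) \<in> segment e"
  moreover have "p = (1/2, 1/2) + (p - (1/2, 1/2))" by (simp add: prod_eq_iff)
  ultimately show "p \<in> dual_segment e" unfolding dual_segment_eq by (rule rev_image_eqI)
qed

lemma dual_segment_Hor:
  "dual_segment (Hor i j) = {of_int i + 1/2..of_int i + 3/2} \<times> {of_int j + 1/2}"
proof (rule set_eqI)
  fix p
  show "p \<in> dual_segment (Hor i j) \<longleftrightarrow> p \<in> {of_int i + 1/2..of_int i + 3/2} \<times> {of_int j + 1/2}"
    unfolding mem_dual_segment_iff segment_Hor by (cases p) auto
qed

lemma dual_segment_Ver:
  "dual_segment (Ver i j) = {of_int i + 1/2} \<times> {of_int j + 1/2..of_int j + 3/2}"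
proof (rule set_eqI)
  fix p
  show "p \<in> dual_segment (Ver i j) \<longleftrightarrow> p \<in> {of_int i + 1/2} \<times> {of_int j + 1/2..of_int j + 3/2}"
    unfolding mem_dual_segment_iff segment_Ver by (cases p) auto
qed

lemma half_int_neq: "real_of_int i \<noteq> of_int j + 1/2"
proof
  assume "real_of_int i = of_int j + 1/2"
  then have "real_of_int (2 * i) = real_of_int (2 * j + 1)" by simp
  then have "2 * i = 2 * j + 1" by (simp only: of_int_eq_iff)
  then show False by presburger
qed

lemma half_int_between:
  "of_int i \<le> real_of_int j + 1/2 \<and> real_of_int j + 1/2 \<le> of_int i + 1 \<longleftrightarrow> i = j"
  "of_int i + 1/2 \<le> real_of_int j \<and> real_of_int j \<le> of_int i + 3/2 \<longleftrightarrow> i = j - 1"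
  by linarith+

lemma crosses_iff: "segment b \<inter> dual_segment e \<noteq> {} \<longleftrightarrow> e = dual_bond b"
proof (cases b; cases e)
  fix i j k l
  show ?thesis if "b = Hor i j" "e = Hor k l"
    using that half_int_neq[of j l] by (auto simp: segment_Hor dual_segment_Hor)
  show ?thesis if "b = Ver i j" "e = Ver k l"
    using that half_int_neq[of i k] by (auto simp: segment_Ver dual_segment_Ver)
  show ?thesis if "b = Hor i j" "e = Ver k l"
    using that half_int_between(1)[of i k] half_int_between(2)[of l j]
    by (auto simp: segment_Hor dual_segment_Ver Times_Int_Times)
  show ?thesis if "b = Ver i j" "e = Hor k l"
    using that half_int_between(1)[of j l] half_int_between(2)[of k i]
    by (auto simp: segment_Ver dual_segment_Hor Times_Int_Times)
qed

lemma dist_eq_1_cases: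
  assumes "dist (point x) (point y) = 1"
  shows "{x, y} \<in> range endpoints"
proof -
  obtain a b c d where xy: "x = (a, b)" "y = (c, d)" by (metis surj_pair)
  have "(real_of_int a - of_int c)\<^sup>2 + (real_of_int b - of_int d)\<^sup>2 = 1"
    using assms unfolding xy by (simp add: point_def dist_prod_def dist_real_def)
  then have "real_of_int ((a - c)\<^sup>2 + (b - d)\<^sup>2) = real_of_int 1" by simp
  then have eq: "(a - c)\<^sup>2 + (b - d)\<^sup>2 = 1" by (simp only: of_int_eq_iff)
  have le: "k\<^sup>2 \<le> 1 \<Longrightarrow> k \<in> {-1, 0, 1}" for k :: int
    using abs_square_le_1[of k] by auto
  have "(a - c)\<^sup>2 \<ge> 0" "(b - d)\<^sup>2 \<ge> 0" by simp_all
  then have "a - c \<in> {-1, 0, 1}" "b - d \<in> {-1, 0, 1}"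
    using eq by (intro le; linarith)+
  then consider "c = a + 1" "d = b" | "a = c + 1" "d = b" | "c = a" "d = b + 1" | "c = a" "b = d + 1"
    using eq by (auto simp: algebra_simps)
  then show ?thesis
  proof cases
    case 1 then show ?thesis using xy by (intro image_eqI[of _ _ "Hor a b"]) auto
  next
    case 2 then show ?thesis using xy by (intro image_eqI[of _ _ "Hor c d"]) auto
  next
    case 3 then show ?thesis using xy by (intro image_eqI[of _ _ "Ver a b"]) auto
  next
    case 4 then show ?thesis using xy by (intro image_eqI[of _ _ "Ver c d"]) auto
  qed
qed

lemma bij_betw_endpoints:
  "bij_betw endpoints UNIV {{x, y} | x y. dist (point x) (point y) = 1}"
proof -
  have "inj endpoints"
  proof (rule injI)
    fix b c show "endpoints b = endpoints c \<Longrightarrow> b = c"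
      by (cases b; cases c) (auto simp: doubleton_eq_iff)
  qed
  moreover have "\<exists>x y. endpoints b = {x, y} \<and> dist (point x) (point y) = 1" for b
  proof (cases b)
    case (Hor i j)
    then have "endpoints b = {(i, j), (i + 1, j)} \<and> dist (point (i, j)) (point (i + 1, j)) = 1"
      by (simp add: point_def dist_prod_def dist_real_def)
    then show ?thesis by blast
  next
    case (Ver i j)
    then have "endpoints b = {(i, j), (i, j + 1)} \<and> dist (point (i, j)) (point (i, j + 1)) = 1"
      by (simp add: point_def dist_prod_def dist_real_def)
    then show ?thesis by blast
  qed
  ultimately show ?thesis
    using dist_eq_1_cases unfolding bij_betw_def by blast
qed

lemma rectangle_boundary:
  fixes l u m v :: real
  assumes "l < u" "m < v"
  shows "{l..u} \<times> {m..v} - {l<..<u} \<times> {m<..<v} = {l..u} \<times> {m, v} \<union> {l, u} \<times> {m..v}"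
proof (rule set_eqI)
  fix p
  show "(p \<in> {l..u} \<times> {m..v} - {l<..<u} \<times> {m<..<v})
      = (p \<in> {l..u} \<times> {m, v} \<union> {l, u} \<times> {m..v})"
    unfolding Diff_iff Un_iff mem_Times_iff atLeastAtMost_iff greaterThanLessThan_iff
      insert_iff empty_iff
    using assms by argo
qed

lemma frontier_plaquette:
  "frontier (plaquette (i, j)) =
    {of_int i - 1/2..of_int i + 1/2} \<times> {of_int j - 1/2, of_int j + 1/2}
    \<union> {of_int i - 1/2, of_int i + 1/2} \<times> {of_int j - 1/2..of_int j + 1/2}"
proof -
  have "plaquette (i, j) =
      {of_int i - 1/2..of_int i + 1/2} \<times> {of_int j - 1/2..of_int j + 1/2}"
    by (simp add: plaquette_def point_def cbox_Pair_eq)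
  then have "frontier (plaquette (i, j)) =
      {of_int i - 1/2..of_int i + 1/2} \<times> {of_int j - 1/2..of_int j + 1/2}
      - {of_int i - 1/2<..<of_int i + 1/2} \<times> {of_int j - 1/2<..<of_int j + 1/2}"
    by (simp add: frontier_def closure_Times interior_Times interior_atLeastAtMost_real)
  also have "\<dots> = {of_int i - 1/2..of_int i + 1/2} \<times> {of_int j - 1/2, of_int j + 1/2}
    \<union> {of_int i - 1/2, of_int i + 1/2} \<times> {of_int j - 1/2..of_int j + 1/2}"
    by (rule rectangle_boundary) linarith+
  finally show ?thesis .
qed

lemma dual_segment_subset_frontier_iff:
  "dual_segment (dual_bond b) \<subseteq> frontier (plaquette t) \<longleftrightarrow> t \<in> endpoints b"
proof (cases b)
  case (Hor k l)
  obtain i j where t: "t = (i, j)" by fastforce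
  have eq: "dual_segment (dual_bond b) = {of_int k + 1/2} \<times> {of_int l - 1/2..of_int l + 1/2}"
    using Hor by (simp add: dual_segment_Ver add.commute)
  show ?thesis
  proof
    assume "dual_segment (dual_bond b) \<subseteq> frontier (plaquette t)"
    moreover have "(of_int k + 1/2, of_int l) \<in> dual_segment (dual_bond b)"
      by (simp add: eq)
    ultimately have "(of_int k + 1/2, of_int l) \<in> frontier (plaquette (i, j))"
      unfolding t by blast
    moreover have "real_of_int l \<noteq> of_int j + 1/2" "real_of_int l \<noteq> of_int j - 1/2"
      using half_int_neq[of l j] half_int_neq[of l "j - 1"] by auto
    ultimately have "of_int k + 1/2 \<in> {of_int i - 1/2, real_of_int i + 1/2}"
      and "of_int l \<in> {of_int j - 1/2..real_of_int j + 1/2}"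
      by (auto simp: frontier_plaquette)
    then have "k = i \<or> k = i - 1" "l = j" by (auto; linarith)+
    then show "t \<in> endpoints b" using Hor t by auto
  next
    assume "t \<in> endpoints b"
    then show "dual_segment (dual_bond b) \<subseteq> frontier (plaquette t)"
      unfolding eq t frontier_plaquette using Hor t by auto
  qed
next
  case (Ver k l)
  obtain i j where t: "t = (i, j)" by fastforce
  have eq: "dual_segment (dual_bond b) = {of_int k - 1/2..of_int k + 1/2} \<times> {of_int l + 1/2}"
    using Ver by (simp add: dual_segment_Hor add.commute)
  show ?thesis
  proof
    assume "dual_segment (dual_bond b) \<subseteq> frontier (plaquette t)"
    moreover have "(of_int k, of_int l + 1/2) \<in> dual_segment (dual_bond b)"
      by (simp add: eq)
    ultimately have "(of_int k, of_int l + 1/2) \<in> frontier (plaquette (i, j))"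
      unfolding t by blast
    moreover have "real_of_int k \<noteq> of_int i + 1/2" "real_of_int k \<noteq> of_int i - 1/2"
      using half_int_neq[of k i] half_int_neq[of k "i - 1"] by auto
    ultimately have "of_int l + 1/2 \<in> {of_int j - 1/2, real_of_int j + 1/2}"
      and "of_int k \<in> {of_int i - 1/2..real_of_int i + 1/2}"
      by (auto simp: frontier_plaquette)
    then have "l = j \<or> l = j - 1" "k = i" by (auto; linarith)+
    then show "t \<in> endpoints b" using Ver t by auto
  next
    assume "t \<in> endpoints b"
    then show "dual_segment (dual_bond b) \<subseteq> frontier (plaquette t)"
      unfolding eq t frontier_plaquette using Ver t by auto
  qed
qed

lemma bonds_star_eq: "bonds_star \<Lambda> = dual_bond ` bonds_plus \<Lambda>"
proof (intro equalityI subsetI)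
  fix e assume e: "e \<in> bonds_star \<Lambda>"
  obtain b where b: "e = dual_bond b" using bij_dual_bond by (metis bij_pointE)
  with e show "e \<in> dual_bond ` bonds_plus \<Lambda>"
    by (auto simp: bonds_star_def bonds_plus_def dual_segment_subset_frontier_iff)
qed (auto simp: bonds_star_def bonds_plus_def dual_segment_subset_frontier_iff)

lemma finite_bonds_plus:
  assumes "finite \<Lambda>"
  shows "finite (bonds_plus \<Lambda>)"
proof -
  have "bonds_plus \<Lambda> \<subseteq>
      (\<Union>(i, j)\<in>\<Lambda>. {Hor i j, Hor (i - 1) j, Ver i j, Ver i (j - 1)})" (is "_ \<subseteq> ?U")
  proof
    fix b assume "b \<in> bonds_plus \<Lambda>"
    then show "b \<in> ?U" by (cases b) (auto simp: bonds_plus_def intro: rev_bexI)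
  qed
  moreover have "finite ?U" using assms by auto
  ultimately show ?thesis by (rule finite_subset)
qed

lemma finite_configs_outside:
  assumes "finite B"
  shows "finite (configs_outside v B)"
proof -
  have "inj_on (\<lambda>n. restrict n B) (configs_outside v B)"
  proof (rule inj_onI)
    fix m n assume mn: "m \<in> configs_outside v B" "n \<in> configs_outside v B"
      "restrict m B = restrict n B"
    show "m = n"
    proof
      fix b show "m b = n b"
        using mn(1,2) fun_cong[OF mn(3), of b]
        by (cases "b \<in> B") (simp_all add: configs_outside_def restrict_def)
    qed
  qed
  moreover have "(\<lambda>n. restrict n B) ` configs_outside v B \<subseteq> B \<rightarrow>\<^sub>E UNIV"
    by (auto simp: restrict_PiE_iff)
  moreover have "finite (B \<rightarrow>\<^sub>E (UNIV :: (bool \<times> bool) set))"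
    using assms by (intro finite_PiE) simp_all
  ultimately show ?thesis by (rule inj_on_finite)
qed

lemma prob_space_rc_measure:
  assumes B: "finite B" and q: "q\<^sub>\<sigma> > 0" "q\<^sub>\<tau> > 0"
    and nonneg: "\<And>b. a\<^sub>0 b \<ge> 0" "\<And>b. a\<^sub>\<sigma> b \<ge> 0" "\<And>b. a\<^sub>\<tau> b \<ge> 0" "\<And>b. a\<^sub>\<sigma>\<^sub>\<tau> b \<ge> 0"
    and pos: "\<And>b. a\<^sub>0 b + a\<^sub>\<sigma> b + a\<^sub>\<tau> b + a\<^sub>\<sigma>\<^sub>\<tau> b > 0"
  shows "prob_space (rc_measure v B S a\<^sub>0 a\<^sub>\<sigma> a\<^sub>\<tau> a\<^sub>\<sigma>\<^sub>\<tau> q\<^sub>\<sigma> q\<^sub>\<tau>)"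
proof -
  let ?C = "configs_outside v B"
  let ?w = "rc_weight B S a\<^sub>0 a\<^sub>\<sigma> a\<^sub>\<tau> a\<^sub>\<sigma>\<^sub>\<tau> q\<^sub>\<sigma> q\<^sub>\<tau>"
  have fin: "finite ?C" by (rule finite_configs_outside[OF B])
  have w: "?w n \<ge> 0" for n
    unfolding rc_weight_def bond_weight_def
    using nonneg q by (intro mult_nonneg_nonneg prod_nonneg zero_le_power) auto
  define n where "n b = (if b \<notin> B then v else if a\<^sub>0 b > 0 then (False, False)
      else if a\<^sub>\<sigma> b > 0 then (True, False) else if a\<^sub>\<tau> b > 0 then (False, True)
      else (True, True))" for b
  have "n \<in> ?C" by (simp add: n_def configs_outside_def)
  moreover have "?w n > 0"
  proof -
    have "bond_weight B a\<^sub>0 a\<^sub>\<sigma> a\<^sub>\<tau> a\<^sub>\<sigma>\<^sub>\<tau> n > 0"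
      unfolding bond_weight_def
    proof (rule prod_pos, goal_cases)
      case (1 b)
      then show ?case
        using nonneg[of b] pos[of b] by (auto simp: n_def)
    qed
    then show ?thesis using q by (simp add: rc_weight_def)
  qed
  ultimately have Z: "(\<Sum>m\<in>?C. ?w m) > 0"
    using fin w by (intro sum_pos2[of ?C n]) auto
  have "(\<Sum>m\<in>?C. ?w m / (\<Sum>k\<in>?C. ?w k)) = 1"
    using Z by (simp flip: sum_divide_distrib)
  then have "(\<Sum>m\<in>?C. ennreal (?w m / (\<Sum>k\<in>?C. ?w k))) = 1"
    using w Z by (subst sum_ennreal) auto
  then show ?thesis
    unfolding rc_measure_def
    by (intro prob_spaceI) (simp add: space_point_measure emeasure_point_measure_finite[OF fin])
qed

end

theory Submission
  imports Defs
begin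

text \<open>
  Let \<open>F\<close> be the set of open dual bonds. Opening one more dual bond \<open>e\<close> closes the bond
  \<open>b\<close> that it crosses, and the endpoints of \<open>b\<close> get disconnected if and only if the endpoints
  of \<open>e\<close> were already connected in \<open>F\<close>. Both directions are parity arguments modulo 2:
  a path in \<open>F\<close> closed up by \<open>e\<close> has even degrees and hence is the boundary of a set of
  plaquettes, which separates the endpoints of \<open>b\<close>; conversely, the boundary of a cluster at one
  endpoint of \<open>b\<close> is a set of dual bonds with even degrees, so by the handshake lemma the
  endpoints of \<open>e\<close> are connected in it without using \<open>e\<close>. It follows that the number of
  clusters minus the number of dual clusters minus the number of open dual bonds is constant, so
  that the two weights are proportional.
\<close>

section \<open>Clusters\<close>

lemma sym_open_edges: "sym (open_edges \<eta>)"
  by (auto simp: open_edges_def sym_def insert_commute)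

lemma equiv_open_edges: "equiv UNIV ((open_edges \<eta>)\<^sup>*)"
  by (intro equivI sym_rtrancl sym_open_edges refl_rtrancl trans_rtrancl) auto

text \<open>A cluster meeting \<open>S\<close> is the class of any of its points in
  \<open>S\<close>, so for finite \<open>S\<close> the count becomes the cardinality of the image of
  a finite set.\<close>

lemma cluster_number_eq:
  "cluster_number \<eta> S = card ((\<lambda>p. (open_edges \<eta>)\<^sup>* `` {p}) ` S)"
proof -
  have "{C \<in> clusters \<eta>. C \<inter> S \<noteq> {}} = (\<lambda>p. (open_edges \<eta>)\<^sup>* `` {p}) ` S"
  proof (intro equalityI subsetI)
    fix C assume "C \<in> {C \<in> clusters \<eta>. C \<inter> S \<noteq> {}}"
    then obtain p q where "C = (open_edges \<eta>)\<^sup>* `` {p}" "q \<in> C" "q \<in> S"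
      by (auto simp: clusters_def quotient_def)
    then show "C \<in> (\<lambda>p. (open_edges \<eta>)\<^sup>* `` {p}) ` S"
      using equiv_class_eq[OF equiv_open_edges, of p q \<eta>] by auto
  qed (auto simp: clusters_def quotient_def)
  then show ?thesis by (simp add: cluster_number_def)
qed

lemma cluster_number_no_bonds: "cluster_number (\<lambda>_. False) S = card S"
proof -
  have "open_edges (\<lambda>_. False) = {}" by (simp add: open_edges_def)
  then show ?thesis by (simp add: cluster_number_eq card_image inj_on_def)
qed

lemma open_edges_open_bond:
  assumes "endpoints b = {x, y}"
  shows "open_edges (\<eta>(b := True)) = insert (x, y) (insert (y, x) (open_edges \<eta>))"
proof -
  have "(\<exists>c. (\<eta>(b := True)) c \<and> endpoints c = {p, q})
      \<longleftrightarrow> endpoints b = {p, q} \<or> (\<exists>c. \<eta> c \<and> endpoints c = {p, q})" for p q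
    by (metis fun_upd_other fun_upd_same)
  then show ?thesis
    using assms by (auto simp only: open_edges_def doubleton_eq_iff)
qed

lemma card_merge:
  assumes "finite A" "X \<in> A" "Y \<in> A" "X \<noteq> Y" "Z \<notin> A - {X, Y}"
  shows "card A = card (insert Z (A - {X, Y})) + 1"
proof -
  have "card A = Suc (Suc (card (A - {X} - {Y})))"
    using assms card.remove[of A X] card.remove[of "A - {X}" Y] by simp
  moreover have "A - {X} - {Y} = A - {X, Y}" by auto
  ultimately show ?thesis using assms by simp
qed

text \<open>Opening \<open>b\<close> merges the classes of \<open>x\<close> and \<open>y\<close> and
  leaves all others alone. As both endpoints lie in \<open>S\<close>, both classes are counted
  before the merger, so it costs exactly one. If \<open>b\<close> is open already, \<open>x\<close>
  and \<open>y\<close> are connected and nothing changes.\<close>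

lemma cluster_number_open_bond:
  assumes b: "endpoints b = {x, y}" and S: "endpoints b \<subseteq> S" "finite S"
  shows "cluster_number \<eta> S =
    cluster_number (\<eta>(b := True)) S + (if (x, y) \<in> (open_edges \<eta>)\<^sup>* then 0 else 1)"
proof -
  define R where "R = (open_edges \<eta>)\<^sup>*"
  define R' where "R' = (open_edges (\<eta>(b := True)))\<^sup>*"
  have refl: "(p, p) \<in> R" for p by (simp add: R_def)
  have symR: "(p, q) \<in> R \<Longrightarrow> (q, p) \<in> R" for p q
    unfolding R_def using sym_rtrancl[OF sym_open_edges] by (metis symD)
  have transR: "(p, q) \<in> R \<Longrightarrow> (q, r) \<in> R \<Longrightarrow> (p, r) \<in> R" for p q r
    unfolding R_def by (rule rtrancl_trans)
  have "R' = (insert (x, y) (insert (y, x) (open_edges \<eta>)))\<^sup>*"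
    by (simp only: R'_def open_edges_open_bond[OF b])
  \<comment> \<open>A path that uses the new bond can be shortened so that it crosses it once, in
    one of the two directions.\<close>
  then have R': "(p, q) \<in> R' \<longleftrightarrow>
      (p, q) \<in> R \<or> (p, x) \<in> R \<and> (y, q) \<in> R \<or> (p, y) \<in> R \<and> (x, q) \<in> R" for p q
    unfolding rtrancl_insert R_def[symmetric] by (auto intro: refl transR)
  have xy: "x \<in> S" "y \<in> S" using b S by auto
  show ?thesis
  proof (cases "(x, y) \<in> R")
    case True
    then have "(p, q) \<in> R' \<longleftrightarrow> (p, q) \<in> R" for p q
      unfolding R' using transR symR by blast
    then have "R' = R" by auto
    then show ?thesis using True by (simp add: cluster_number_eq R_def R'_def)
  next
    case False
    define A where "A = (\<lambda>p. R `` {p}) ` S"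
    let ?X = "R `` {x}" and ?Y = "R `` {y}"
    have rel: "(p, q) \<in> R' \<longleftrightarrow>
        (if (x, p) \<in> R \<or> (y, p) \<in> R then (x, q) \<in> R \<or> (y, q) \<in> R else (p, q) \<in> R)" for p q
      by (smt (verit) R' refl symR transR)
    have cls: "R' `` {p} = (if p \<in> ?X \<union> ?Y then ?X \<union> ?Y else R `` {p})" for p
      by (rule set_eqI) (simp add: rel)
    have cls_eq: "R `` {p} = R `` {q} \<longleftrightarrow> q \<in> R `` {p}" for p q
      using eq_equiv_class_iff[OF equiv_open_edges] by (simp add: R_def)
    have "(\<lambda>p. R' `` {p}) ` S = insert (?X \<union> ?Y) (A - {?X, ?Y})"
    proof (intro equalityI subsetI)
      fix C assume "C \<in> (\<lambda>p. R' `` {p}) ` S"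
      then obtain p where p: "p \<in> S" "C = R' `` {p}" by blast
      show "C \<in> insert (?X \<union> ?Y) (A - {?X, ?Y})"
      proof (cases "p \<in> ?X \<union> ?Y")
        case True
        then show ?thesis using p by (simp add: cls)
      next
        case False
        then have "C = R `` {p}" using p by (simp add: cls)
        moreover have "R `` {p} \<noteq> ?X" "R `` {p} \<noteq> ?Y"
          using False cls_eq[of x p] cls_eq[of y p] by (metis Un_iff)+
        ultimately show ?thesis using p by (simp add: A_def)
      qed
    next
      fix C assume "C \<in> insert (?X \<union> ?Y) (A - {?X, ?Y})"
      then consider "C = ?X \<union> ?Y" | p where "p \<in> S" "C = R `` {p}" "C \<noteq> ?X" "C \<noteq> ?Y"
        by (auto simp: A_def)
      then show "C \<in> (\<lambda>p. R' `` {p}) ` S"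
      proof cases
        case 1
        then have "C = R' `` {x}" using cls refl by simp
        then show ?thesis using xy by blast
      next
        case 2
        then have "p \<notin> ?X \<union> ?Y" using cls_eq[of x p] cls_eq[of y p] by (metis Un_iff)
        then have "C = R' `` {p}" using 2 by (simp add: cls)
        then show ?thesis using 2 by blast
      qed
    qed
    moreover have "card A = card (insert (?X \<union> ?Y) (A - {?X, ?Y})) + 1"
    proof (rule card_merge)
      show "finite A" "?X \<in> A" "?Y \<in> A" using S xy by (auto simp: A_def)
      show "?X \<noteq> ?Y" using False cls_eq[of x y] by simp
      have "C = ?X" if C: "C \<in> A" "C = ?X \<union> ?Y" for C
      proof -
        obtain p where p: "C = R `` {p}" using C(1) unfolding A_def by blast
        have "x \<in> C" using C(2) refl by simp
        then show ?thesis using p cls_eq[of p x] by simp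
      qed
      then show "?X \<union> ?Y \<notin> A - {?X, ?Y}" by blast
    qed
    ultimately show ?thesis
      using False by (simp add: cluster_number_eq A_def flip: R_def R'_def)
  qed
qed

section \<open>Parity of degrees\<close>

definition degree :: "bond set \<Rightarrow> site \<Rightarrow> nat" where
  "degree D s = card {e \<in> D. s \<in> endpoints e}"

lemma finite_endpoints [simp]: "finite (endpoints b)"
  by (cases b) auto

lemma endpoints_iff:
  "(k, l) \<in> endpoints e \<longleftrightarrow> e \<in> {Ver k (l - 1), Ver k l, Hor (k - 1) l, Hor k l}"
  by (cases e) auto

lemma endpoints_neq: "endpoints b = {x, y} \<Longrightarrow> x \<noteq> y"
  by (cases b) (auto simp: doubleton_eq_iff)

text \<open>Four bonds meet at a site, so the parity of the degree is the exclusive or of four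
  memberships, for any \<open>D\<close>. This propositional form is what the later case distinctions
  use.\<close>

lemma odd_degree_iff:
  "odd (degree D (k, l)) \<longleftrightarrow>
    ((Ver k (l - 1) \<in> D) \<noteq> (Ver k l \<in> D)) \<noteq> ((Hor (k - 1) l \<in> D) \<noteq> (Hor k l \<in> D))"
proof -
  have "{e \<in> D. (k, l) \<in> endpoints e} = {Ver k (l - 1), Ver k l, Hor (k - 1) l, Hor k l} \<inter> D"
    by (auto simp only: endpoints_iff)
  then show ?thesis by (simp add: degree_def Int_insert_left)
qed

lemma odd_degree_insert:
  assumes "e \<notin> D"
  shows "odd (degree (insert e D) s) \<longleftrightarrow> (odd (degree D s) \<noteq> (s \<in> endpoints e))"
  using assms by (cases s; cases e) (auto simp: odd_degree_iff)

lemma odd_degree_remove: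
  assumes "e \<in> D"
  shows "odd (degree (D - {e}) s) \<longleftrightarrow> (odd (degree D s) \<noteq> (s \<in> endpoints e))"
  using odd_degree_insert[of e "D - {e}" s] assms by (auto simp: insert_absorb)

text \<open>\<open>P\<close> is the walk taken modulo 2: traversing a bond toggles its membership
  and flips the parity at its two endpoints, so a bond traversed twice cancels and \<open>P\<close>
  has boundary \<open>u + v\<close>.\<close>

lemma path_odd_degree:
  assumes "(u, v) \<in> (open_edges (\<lambda>e. e \<in> F))\<^sup>*"
  shows "\<exists>P\<subseteq>F. \<forall>s. odd (degree P s) \<longleftrightarrow> (s = u) \<noteq> (s = v)"
  using assms
proof (induction rule: rtrancl_induct)
  case base
  show ?case by (intro exI[of _ "{}"]) (simp add: degree_def)
next
  case (step v w)
  then obtain P where P: "P \<subseteq> F" "\<And>s. odd (degree P s) \<longleftrightarrow> (s = u) \<noteq> (s = v)" by blast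
  obtain e where e: "e \<in> F" "endpoints e = {v, w}"
    using step by (auto simp: open_edges_def)
  have "v \<noteq> w" using e endpoints_neq by blast
  show ?case
  proof (cases "e \<in> P")
    case True
    show ?thesis
      using P e \<open>v \<noteq> w\<close> odd_degree_remove[OF True] by (intro exI[of _ "P - {e}"]) auto
  next
    case False
    show ?thesis
      using P e \<open>v \<noteq> w\<close> odd_degree_insert[OF False] by (intro exI[of _ "insert e P"]) auto
  qed
qed

text \<open>Handshake argument in the \<open>F\<close>-cluster of \<open>u\<close>: if
  \<open>v\<close> were outside it, \<open>e\<close> would contribute 1 to the degree sum and every
  other bond of \<open>D\<close> 0 or 2, although all degrees are even.\<close>

lemma even_degree_imp_connected:
  assumes "finite D" and even: "\<And>s. even (degree D s)"
    and e: "e \<in> D" "endpoints e = {u, v}" and F: "D - {e} \<subseteq> F"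
  shows "(u, v) \<in> (open_edges (\<lambda>e. e \<in> F))\<^sup>*"
proof (rule ccontr)
  assume nc: "(u, v) \<notin> (open_edges (\<lambda>e. e \<in> F))\<^sup>*"
  define K where "K = (open_edges (\<lambda>e. e \<in> F))\<^sup>* `` {u}"
  \<comment> \<open>The cluster \<open>K\<close> may be infinite; only the finitely many sites on
    bonds of \<open>D\<close> have nonzero degree.\<close>
  define V where "V = K \<inter> bond_sites D"
  have V: "finite V" using assms(1) by (simp add: V_def bond_sites_def)
  \<comment> \<open>Double counting of the incidences between sites of \<open>V\<close> and bonds of
    \<open>D\<close>.\<close>
  have "(\<Sum>s\<in>V. degree D s) = (\<Sum>s\<in>V. \<Sum>d\<in>D. of_bool (s \<in> endpoints d))"
    using assms(1) by (simp add: degree_def Int_def)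
  also have "\<dots> = (\<Sum>d\<in>D. \<Sum>s\<in>V. of_bool (s \<in> endpoints d))"
    by (rule sum.swap)
  also have "\<dots> = (\<Sum>d\<in>D. card (endpoints d \<inter> V))"
    using V by (simp add: Int_def conj_commute)
  also have "\<dots> = card (endpoints e \<inter> V) + (\<Sum>d\<in>D - {e}. card (endpoints d \<inter> V))"
    using assms(1) e(1) by (rule sum.remove)
  also have "endpoints e \<inter> V = {u}"
    using e nc by (auto simp: V_def K_def bond_sites_def)
  finally have "(\<Sum>s\<in>V. degree D s) = 1 + (\<Sum>d\<in>D - {e}. card (endpoints d \<inter> V))" by simp
  moreover have "even (\<Sum>d\<in>D - {e}. card (endpoints d \<inter> V))"
  proof (rule dvd_sum)
    fix d assume d: "d \<in> D - {e}"
    obtain p q where pq: "endpoints d = {p, q}" by (cases d) auto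
    have "d \<in> F" using d F by blast
    then have "(p, q) \<in> open_edges (\<lambda>e. e \<in> F)" "(q, p) \<in> open_edges (\<lambda>e. e \<in> F)"
      using pq by (auto simp: open_edges_def insert_commute)
    then have "p \<in> K \<longleftrightarrow> q \<in> K"
      unfolding K_def by (auto intro: rtrancl_into_rtrancl)
    moreover have "p \<in> bond_sites D" "q \<in> bond_sites D"
      using d pq by (auto simp: bond_sites_def)
    ultimately have "endpoints d \<inter> V = {p, q} \<or> endpoints d \<inter> V = {}"
      using pq by (auto simp: V_def)
    then show "even (card (endpoints d \<inter> V))"
      using endpoints_neq[OF pq] by auto
  qed
  moreover have "even (\<Sum>s\<in>V. degree D s)" using even by (intro dvd_sum) auto
  ultimately show False by simp
qed

section \<open>Planar duality\<close>

lemma inj_dual_bond: "inj dual_bond"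
  using bij_dual_bond by (rule bij_is_inj)

text \<open>A discrete Jordan theorem modulo 2: a finite even set of dual bonds bounds a set of
  plaquettes, with indicator \<open>h\<close>. Horizontal steps change the ray count by
  construction; vertical steps need the even degrees.\<close>

lemma even_degree_imp_separating:
  assumes "finite Q" and even: "\<And>s. even (degree Q s)"
  shows "\<exists>h :: site \<Rightarrow> bool. \<forall>b x y. endpoints b = {x, y} \<longrightarrow> ((h x \<noteq> h y) \<longleftrightarrow> dual_bond b \<in> Q)"
proof -
  \<comment> \<open>The bonds of \<open>Q\<close> crossed by the horizontal ray from \<open>(i, j)\<close> to the right; the parity
    of their number is the side of \<open>(i, j)\<close>.\<close>
  define K where "K i j = {k. i \<le> k \<and> Ver k (j - 1) \<in> Q}" for i j
  define h where "h s = odd (card (K (fst s) (snd s)))" for s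
  have "inj (\<lambda>k. Ver k l)" for l by (simp add: inj_def)
  then have finK: "finite (K i j)" for i j
    unfolding K_def
    by (intro finite_subset[OF _ finite_vimageI[OF assms(1), of "\<lambda>k. Ver k (j - 1)"]]) auto
  have hor: "h (i, j) \<longleftrightarrow> (h (i + 1, j) \<noteq> (Ver i (j - 1) \<in> Q))" for i j
  proof -
    have "K i j = (if Ver i (j - 1) \<in> Q then insert i (K (i + 1) j) else K (i + 1) j)"
      by (auto simp: K_def order_le_less)
    moreover have "i \<notin> K (i + 1) j" by (simp add: K_def)
    ultimately show ?thesis using finK by (simp add: h_def)
  qed
  have "finite (fst ` bond_sites Q)" using assms(1) by (simp add: bond_sites_def)
  \<comment> \<open>To the right of all sites of \<open>Q\<close> the rays meet nothing, so
    \<open>h\<close> is false there; this starts the induction that moves left.\<close>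
  then obtain M where M: "\<And>k l. (k, l) \<in> bond_sites Q \<Longrightarrow> k < M"
    by (metis bdd_above_def bdd_above_finite dual_order.strict_trans1 fst_conv image_eqI
        linorder_not_le zle_add1_eq_le)
  have far: "(h (i, j) \<noteq> h (i, j + 1)) \<longleftrightarrow> Hor (i - 1) j \<in> Q" if "i \<ge> M" for i j
  proof -
    have out: "(k, l) \<notin> bond_sites Q" if "k \<ge> i" for k l
      using M[of k l] that \<open>i \<ge> M\<close> by linarith
    have "K i l = {}" for l
      using out by (fastforce simp: K_def bond_sites_def)
    moreover have "Hor (i - 1) j \<notin> Q"
      using out[of i j] by (force simp: bond_sites_def)
    ultimately show ?thesis by (simp add: h_def)
  qed
  have ver: "(h (i, j) \<noteq> h (i, j + 1)) \<longleftrightarrow> Hor (i - 1) j \<in> Q" for i j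
  proof (cases "i \<ge> M")
    case True
    then show ?thesis by (rule far)
  next
    case False
    then have "i \<le> M" by simp
    then show ?thesis
    proof (induction i rule: int_le_induct)
      case base
      show ?case by (rule far) simp
    next
      case (step i)
      \<comment> \<open>The dual site with index \<open>(i - 1, j)\<close> is the centre of the unit
        square with corners \<open>(i - 1, j)\<close> and \<open>(i, j + 1)\<close>. Its four dual
        bonds cross the sides of that square, so three of the sides determine the change of
        \<open>h\<close> along the fourth.\<close>
      have "((Ver (i - 1) (j - 1) \<in> Q) \<noteq> (Ver (i - 1) j \<in> Q))
          = ((Hor (i - 1 - 1) j \<in> Q) \<noteq> (Hor (i - 1) j \<in> Q))"
        using even[of "(i - 1, j)"] odd_degree_iff[of Q "i - 1" j] by blast
      moreover have "h (i - 1, j) \<longleftrightarrow> (h (i, j) \<noteq> (Ver (i - 1) (j - 1) \<in> Q))"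
        "h (i - 1, j + 1) \<longleftrightarrow> (h (i, j + 1) \<noteq> (Ver (i - 1) j \<in> Q))"
        using hor[of "i - 1" j] hor[of "i - 1" "j + 1"] by simp_all
      ultimately show ?case using step.IH by argo
    qed
  qed
  have "(h x \<noteq> h y) \<longleftrightarrow> dual_bond b \<in> Q" if "endpoints b = {x, y}" for b x y
  proof (cases b)
    case (Hor i j)
    then show ?thesis using that hor[of i j] by (auto simp: doubleton_eq_iff)
  next
    case (Ver i j)
    then show ?thesis using that ver[of i j] by (auto simp: doubleton_eq_iff)
  qed
  then show ?thesis by blast
qed

text \<open>Finiteness of \<open>F\<close> makes both even sets finite: the closed dual path for the
  ray count and the cluster boundary for the handshake argument.\<close>

lemma connected_iff_dual_not_connected:
  assumes F: "finite F" "dual_bond b \<notin> F"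
    and b: "endpoints b = {x, y}" and e: "endpoints (dual_bond b) = {u, v}"
  shows "(x, y) \<in> (open_edges (\<lambda>c. dual_bond c \<notin> insert (dual_bond b) F))\<^sup>*
    \<longleftrightarrow> (u, v) \<notin> (open_edges (\<lambda>e. e \<in> F))\<^sup>*"
proof
  let ?R = "open_edges (\<lambda>c. dual_bond c \<notin> insert (dual_bond b) F)"
  assume xy: "(x, y) \<in> ?R\<^sup>*"
  show "(u, v) \<notin> (open_edges (\<lambda>e. e \<in> F))\<^sup>*"
  proof
    assume "(u, v) \<in> (open_edges (\<lambda>e. e \<in> F))\<^sup>*"
    from path_odd_degree[OF this]
    obtain P where P: "P \<subseteq> F" "\<And>s. odd (degree P s) \<longleftrightarrow> (s = u) \<noteq> (s = v)"
      by blast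
    \<comment> \<open>\<open>P\<close> is odd exactly at \<open>u\<close> and \<open>v\<close> and
      does not contain \<open>dual_bond b\<close>, so adding that bond closes it up.\<close>
    define Q where "Q = insert (dual_bond b) P"
    have fin: "finite Q" using finite_subset[OF P(1) F(1)] by (simp add: Q_def)
    have even: "even (degree Q s)" for s
    proof -
      have "dual_bond b \<notin> P" using P F by blast
      from odd_degree_insert[OF this, of s] show ?thesis
        using P(2)[of s] e endpoints_neq[OF e] by (auto simp: Q_def)
    qed
    from even_degree_imp_separating[OF fin even] obtain h :: "site \<Rightarrow> bool" where
      h: "\<And>b x y. endpoints b = {x, y} \<Longrightarrow> (h x \<noteq> h y) \<longleftrightarrow> dual_bond b \<in> Q"
      by blast
    \<comment> \<open>Bonds of the path have their duals outside \<open>Q\<close>, so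
      \<open>h\<close> is constant along it; yet \<open>h\<close> must change across
      \<open>b\<close>.\<close>
    have "h x = h y" using xy
    proof (induction rule: rtrancl_induct)
      case (step p q)
      then obtain c where "dual_bond c \<notin> insert (dual_bond b) F" "endpoints c = {p, q}"
        by (auto simp: open_edges_def)
      then show ?case using h[of c p q] P step by (auto simp: Q_def)
    qed simp
    then show False using h[OF b] by (simp add: Q_def)
  qed
next
  let ?R = "open_edges (\<lambda>c. dual_bond c \<notin> insert (dual_bond b) F)"
  assume uv: "(u, v) \<notin> (open_edges (\<lambda>e. e \<in> F))\<^sup>*"
  show "(x, y) \<in> ?R\<^sup>*"
  proof (rule ccontr)
    assume xy: "(x, y) \<notin> ?R\<^sup>*"
    define S where "S = ?R\<^sup>* `` {x}"
    \<comment> \<open>The edge boundary of the cluster \<open>S\<close>, seen in the dual. Apart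
      from \<open>dual_bond b\<close> it lies in \<open>F\<close>, so it is finite even when
      \<open>S\<close> is not.\<close>
    define D where "D = dual_bond ` {c. endpoints c \<inter> S \<noteq> {} \<and> \<not> endpoints c \<subseteq> S}"
    have D: "dual_bond c \<in> D \<longleftrightarrow> endpoints c \<inter> S \<noteq> {} \<and> \<not> endpoints c \<subseteq> S" for c
      using inj_dual_bond by (auto simp: D_def inj_eq)
    have DF: "D - {dual_bond b} \<subseteq> F"
    proof
      fix d assume d: "d \<in> D - {dual_bond b}"
      then obtain c where c: "d = dual_bond c" by (auto simp: D_def)
      obtain p q where pq: "endpoints c = {p, q}" "p \<in> S" "q \<notin> S"
        using d c D[of c] by (cases c) (auto simp: insert_commute)
      show "d \<in> F"
      proof (rule ccontr)
        assume "d \<notin> F"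
        then have "(p, q) \<in> ?R" using d c pq by (auto simp: open_edges_def)
        then show False using pq by (auto simp: S_def intro: rtrancl_into_rtrancl)
      qed
    qed
    then have "finite D" using F(1) by (meson finite.emptyI finite.insertI finite_Diff2 finite_subset)
    moreover have "even (degree D s)" for s
    proof -
      obtain k l where s: "s = (k, l)" by fastforce
      \<comment> \<open>Going once around the square centred at the dual site, membership in
        \<open>S\<close> changes an even number of times.\<close>
      have "Ver k (l - 1) \<in> D \<longleftrightarrow> ((k, l) \<in> S) \<noteq> ((k + 1, l) \<in> S)"
        "Ver k l \<in> D \<longleftrightarrow> ((k, l + 1) \<in> S) \<noteq> ((k + 1, l + 1) \<in> S)"
        "Hor (k - 1) l \<in> D \<longleftrightarrow> ((k, l) \<in> S) \<noteq> ((k, l + 1) \<in> S)"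
        "Hor k l \<in> D \<longleftrightarrow> ((k + 1, l) \<in> S) \<noteq> ((k + 1, l + 1) \<in> S)"
        using D[of "Hor k l"] D[of "Hor k (l + 1)"] D[of "Ver k l"] D[of "Ver (k + 1) l"]
        by auto
      then have "\<not> odd (degree D (k, l))" unfolding odd_degree_iff by argo
      then show ?thesis using s by simp
    qed
    moreover have "dual_bond b \<in> D" using b xy by (simp add: D S_def)
    ultimately show False using even_degree_imp_connected DF e uv by metis
  qed
qed

section \<open>The Euler relation between clusters and dual clusters\<close>

lemma finite_bond_sites: "finite B \<Longrightarrow> finite (bond_sites B)"
  by (simp add: bond_sites_def)

lemma endpoints_subset_bond_sites: "b \<in> B \<Longrightarrow> endpoints b \<subseteq> bond_sites B"
  by (auto simp: bond_sites_def)

text \<open>Induction on the open dual bonds: each new one either splits a cluster or merges two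
  dual clusters, never both. The fully open configuration fixes the constant, whose cluster number
  cancels later in the normalization. As \<open>F\<close> lies in the dual of \<open>B\<close>, all
  bonds outside \<open>B\<close> are open, which is the wired boundary condition.\<close>

lemma cluster_number_duality:
  assumes B: "finite B" and F: "F \<subseteq> dual_bond ` B"
  shows "cluster_number (\<lambda>b. dual_bond b \<notin> F) (bond_sites B)
      + card (bond_sites (dual_bond ` B))
    = card F + cluster_number (\<lambda>e. e \<in> F) (bond_sites (dual_bond ` B))
      + cluster_number (\<lambda>_. True) (bond_sites B)"
proof -
  have "finite F" using F B finite_surj by blast
  then show ?thesis using F
  proof (induction F rule: finite_induct)
    case empty
    then show ?case by (simp add: cluster_number_no_bonds)
  next
    case (insert e F)
    then obtain b where b: "e = dual_bond b" "b \<in> B" by auto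
    obtain x y where xy: "endpoints b = {x, y}" by (cases b) auto
    obtain u v where uv: "endpoints e = {u, v}" by (cases e) auto
    \<comment> \<open>Opening \<open>e\<close> closes \<open>b\<close>; read backwards, this is the
      opening of \<open>b\<close> in the configuration that belongs to
      \<open>insert e F\<close>.\<close>
    have "(\<lambda>c. dual_bond c \<notin> insert e F)(b := True) = (\<lambda>c. dual_bond c \<notin> F)"
      using insert.hyps b inj_dual_bond by (auto simp: fun_eq_iff inj_eq)
    then have 1: "cluster_number (\<lambda>c. dual_bond c \<notin> insert e F) (bond_sites B) =
        cluster_number (\<lambda>c. dual_bond c \<notin> F) (bond_sites B)
        + (if (x, y) \<in> (open_edges (\<lambda>c. dual_bond c \<notin> insert e F))\<^sup>* then 0 else 1)"
      using cluster_number_open_bond[OF xy endpoints_subset_bond_sites[OF b(2)]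
          finite_bond_sites[OF B], of "\<lambda>c. dual_bond c \<notin> insert e F"] by simp
    have "(\<lambda>d. d \<in> F)(e := True) = (\<lambda>d. d \<in> insert e F)" by (auto simp: fun_eq_iff)
    then have 2: "cluster_number (\<lambda>d. d \<in> F) (bond_sites (dual_bond ` B)) =
        cluster_number (\<lambda>d. d \<in> insert e F) (bond_sites (dual_bond ` B))
        + (if (u, v) \<in> (open_edges (\<lambda>d. d \<in> F))\<^sup>* then 0 else 1)"
      using cluster_number_open_bond[OF uv endpoints_subset_bond_sites finite_bond_sites,
          of "dual_bond ` B" "\<lambda>d. d \<in> F"] b B by simp
    have "(x, y) \<in> (open_edges (\<lambda>c. dual_bond c \<notin> insert e F))\<^sup>*
        \<longleftrightarrow> (u, v) \<notin> (open_edges (\<lambda>d. d \<in> F))\<^sup>*"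
      using connected_iff_dual_not_connected insert.hyps b(1) xy uv by metis
    then show ?case
      using 1 2 insert by (auto split: if_splits)
  qed
qed

section \<open>Weights and measures\<close>

lemma dual_config_image_configs_outside:
  "dual_config ` configs_outside (True, True) B = configs_outside (False, False) (dual_bond ` B)"
proof (intro equalityI subsetI)
  fix m assume "m \<in> dual_config ` configs_outside (True, True) B"
  then obtain n where n: "m = dual_config n" "n \<in> configs_outside (True, True) B" by blast
  have "m e = (False, False)" if "e \<notin> dual_bond ` B" for e
  proof -
    obtain b where "e = dual_bond b" using bij_dual_bond by (metis bij_pointE)
    then show ?thesis using that n by (auto simp: configs_outside_def)
  qed
  then show "m \<in> configs_outside (False, False) (dual_bond ` B)"
    by (simp add: configs_outside_def)
next
  fix m assume m: "m \<in> configs_outside (False, False) (dual_bond ` B)"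
  obtain n where n: "m = dual_config n" using bij_dual_config by (metis bij_pointE)
  have "n b = (True, True)" if "b \<notin> B" for b
  proof -
    have "dual_bond b \<notin> dual_bond ` B" using that inj_dual_bond by (auto simp: inj_eq)
    then have "dual_config n (dual_bond b) = (False, False)"
      using m n unfolding configs_outside_def by blast
    then show ?thesis by (simp add: prod_eq_iff)
  qed
  then show "m \<in> dual_config ` configs_outside (True, True) B"
    using n by (auto simp: configs_outside_def)
qed

text \<open>The Euler relation for one colour as exponents of \<open>q\<close>. The number of open
  dual bonds is the number of closed bonds in \<open>B\<close>, so it becomes a product with a
  factor \<open>q\<close> for each closed bond.\<close>

lemma cluster_number_dual_power:
  fixes q :: real
  assumes B: "finite B" and "\<And>b. b \<notin> B \<Longrightarrow> \<eta> b" and "\<And>b. \<eta>' (dual_bond b) \<longleftrightarrow> \<not> \<eta> b"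
  shows "(\<Prod>b\<in>B. if \<eta> b then 1 else q) * q ^ cluster_number \<eta>' (bond_sites (dual_bond ` B))
      * q ^ cluster_number (\<lambda>_. True) (bond_sites B)
    = q ^ card (bond_sites (dual_bond ` B)) * q ^ cluster_number \<eta> (bond_sites B)"
proof -
  define G where "G = {b \<in> B. \<not> \<eta> b}"
  define F where "F = dual_bond ` G"
  have \<eta>: "\<eta> = (\<lambda>b. dual_bond b \<notin> F)"
    using assms(2) inj_dual_bond by (auto simp: F_def G_def inj_image_mem_iff)
  have \<eta>': "\<eta>' = (\<lambda>e. e \<in> F)"
  proof
    fix e
    obtain b where "e = dual_bond b" using bij_dual_bond by (metis bij_pointE)
    then show "\<eta>' e = (e \<in> F)" using assms(3) \<eta> by (metis (no_types))
  qed
  have "(\<Prod>b\<in>B. if \<eta> b then 1 else q) = (\<Prod>b\<in>G. q)"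
    unfolding G_def using B by (intro prod.mono_neutral_cong_right) auto
  also have "\<dots> = q ^ card F"
    using inj_dual_bond by (simp add: F_def card_image inj_on_subset)
  finally have prod: "(\<Prod>b\<in>B. if \<eta> b then 1 else q) = q ^ card F" .
  have "F \<subseteq> dual_bond ` B" by (auto simp: F_def G_def)
  then have "cluster_number \<eta> (bond_sites B) + card (bond_sites (dual_bond ` B))
    = card F + cluster_number \<eta>' (bond_sites (dual_bond ` B))
      + cluster_number (\<lambda>_. True) (bond_sites B)"
    by (subst \<eta>, subst \<eta>') (rule cluster_number_duality[OF B])
  then have "q ^ (cluster_number \<eta> (bond_sites B) + card (bond_sites (dual_bond ` B)))
    = q ^ (card F + cluster_number \<eta>' (bond_sites (dual_bond ` B))
      + cluster_number (\<lambda>_. True) (bond_sites B))"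
    by simp
  then show ?thesis by (simp add: prod power_add mult_ac)
qed

section \<open>Proportional weights and equal expectations\<close>

lemma integral_rc_measure:
  fixes f :: "config \<Rightarrow> real"
  assumes "finite B" and "\<And>n. rc_weight B S a\<^sub>0 a\<^sub>\<sigma> a\<^sub>\<tau> a\<^sub>\<sigma>\<^sub>\<tau> q\<^sub>\<sigma> q\<^sub>\<tau> n \<ge> 0"
  shows "(\<integral>n. f n \<partial>(rc_measure v B S a\<^sub>0 a\<^sub>\<sigma> a\<^sub>\<tau> a\<^sub>\<sigma>\<^sub>\<tau> q\<^sub>\<sigma> q\<^sub>\<tau>))
    = (\<Sum>n\<in>configs_outside v B. rc_weight B S a\<^sub>0 a\<^sub>\<sigma> a\<^sub>\<tau> a\<^sub>\<sigma>\<^sub>\<tau> q\<^sub>\<sigma> q\<^sub>\<tau> n * f n)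
      / (\<Sum>n\<in>configs_outside v B. rc_weight B S a\<^sub>0 a\<^sub>\<sigma> a\<^sub>\<tau> a\<^sub>\<sigma>\<^sub>\<tau> q\<^sub>\<sigma> q\<^sub>\<tau> n)"
  unfolding rc_measure_def using assms
  by (subst lebesgue_integral_point_measure_finite)
    (auto simp: finite_configs_outside sum_nonneg sum_divide_distrib)

lemma rc_weight_nonneg:
  assumes "q\<^sub>\<sigma> \<ge> 0" "q\<^sub>\<tau> \<ge> 0"
    and "\<And>b. a\<^sub>0 b \<ge> 0" "\<And>b. a\<^sub>\<sigma> b \<ge> 0" "\<And>b. a\<^sub>\<tau> b \<ge> 0" "\<And>b. a\<^sub>\<sigma>\<^sub>\<tau> b \<ge> 0"
  shows "rc_weight B S a\<^sub>0 a\<^sub>\<sigma> a\<^sub>\<tau> a\<^sub>\<sigma>\<^sub>\<tau> q\<^sub>\<sigma> q\<^sub>\<tau> n \<ge> 0"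
  unfolding rc_weight_def bond_weight_def
  using assms by (intro mult_nonneg_nonneg prod_nonneg zero_le_power) auto

text \<open>Duality swaps (0,0) with (1,1) and fixes (1,0) and (0,1), because the colours are
  exchanged as well as complemented. The extra factors of the dual weights are then one
  \<open>q\<^sub>\<sigma>\<close> for each \<sigma>-closed bond and one
  \<open>q\<^sub>\<tau>\<close> for each \<tau>-closed bond.\<close>

lemma bond_weight_dual_config:
  assumes "\<And>b. a'\<^sub>0 (dual_bond b) = C' b * a\<^sub>\<sigma>\<^sub>\<tau> b"
    and "\<And>b. a'\<^sub>\<sigma> (dual_bond b) = q\<^sub>\<tau> * C' b * a\<^sub>\<sigma> b"
    and "\<And>b. a'\<^sub>\<tau> (dual_bond b) = q\<^sub>\<sigma> * C' b * a\<^sub>\<tau> b"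
    and "\<And>b. a'\<^sub>\<sigma>\<^sub>\<tau> (dual_bond b) = q\<^sub>\<sigma> * q\<^sub>\<tau> * C' b * a\<^sub>0 b"
  shows "bond_weight (dual_bond ` B) a'\<^sub>0 a'\<^sub>\<sigma> a'\<^sub>\<tau> a'\<^sub>\<sigma>\<^sub>\<tau> (dual_config n)
    = (\<Prod>b\<in>B. C' b) * bond_weight B a\<^sub>0 a\<^sub>\<sigma> a\<^sub>\<tau> a\<^sub>\<sigma>\<^sub>\<tau> n
      * (\<Prod>b\<in>B. if fst (n b) then 1 else q\<^sub>\<sigma>) * (\<Prod>b\<in>B. if snd (n b) then 1 else q\<^sub>\<tau>)"
proof -
  have "inj_on dual_bond B" using inj_dual_bond by (rule inj_on_subset) simp
  then show ?thesis
    unfolding bond_weight_def prod.distrib[symmetric]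
    by (subst prod.reindex) (auto intro!: prod.cong simp: assms prod_eq_iff)
qed

lemma rc_weight_dual_config:
  assumes B: "finite B" and q: "q\<^sub>\<sigma> > 0" "q\<^sub>\<tau> > 0" and C': "\<And>b. C' b > 0"
    and a': "\<And>b. a'\<^sub>0 (dual_bond b) = C' b * a\<^sub>\<sigma>\<^sub>\<tau> b"
      "\<And>b. a'\<^sub>\<sigma> (dual_bond b) = q\<^sub>\<tau> * C' b * a\<^sub>\<sigma> b"
      "\<And>b. a'\<^sub>\<tau> (dual_bond b) = q\<^sub>\<sigma> * C' b * a\<^sub>\<tau> b"
      "\<And>b. a'\<^sub>\<sigma>\<^sub>\<tau> (dual_bond b) = q\<^sub>\<sigma> * q\<^sub>\<tau> * C' b * a\<^sub>0 b"
  obtains K where "K > 0"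
    and "\<And>n. n \<in> configs_outside (True, True) B \<Longrightarrow>
      rc_weight (dual_bond ` B) (bond_sites (dual_bond ` B)) a'\<^sub>0 a'\<^sub>\<sigma> a'\<^sub>\<tau> a'\<^sub>\<sigma>\<^sub>\<tau> q\<^sub>\<tau> q\<^sub>\<sigma> (dual_config n)
      = K * rc_weight B (bond_sites B) a\<^sub>0 a\<^sub>\<sigma> a\<^sub>\<tau> a\<^sub>\<sigma>\<^sub>\<tau> q\<^sub>\<sigma> q\<^sub>\<tau> n"
proof -
  let ?V = "bond_sites B" and ?V' = "bond_sites (dual_bond ` B)"
  define t where "t = cluster_number (\<lambda>_. True) ?V"
  \<comment> \<open>The normalizations \<open>C'\<close> and, for each colour, the constant of the
    Euler relation; none depends on \<open>n\<close>.\<close>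
  define K where "K = (\<Prod>b\<in>B. C' b) * (q\<^sub>\<sigma> ^ card ?V' / q\<^sub>\<sigma> ^ t) * (q\<^sub>\<tau> ^ card ?V' / q\<^sub>\<tau> ^ t)"
  have "K > 0" using q C' by (simp add: K_def prod_pos)
  moreover have "rc_weight (dual_bond ` B) ?V' a'\<^sub>0 a'\<^sub>\<sigma> a'\<^sub>\<tau> a'\<^sub>\<sigma>\<^sub>\<tau> q\<^sub>\<tau> q\<^sub>\<sigma> (dual_config n)
      = K * rc_weight B ?V a\<^sub>0 a\<^sub>\<sigma> a\<^sub>\<tau> a\<^sub>\<sigma>\<^sub>\<tau> q\<^sub>\<sigma> q\<^sub>\<tau> n"
    if n: "n \<in> configs_outside (True, True) B" for n
  proof -
    define P\<^sub>\<sigma> where "P\<^sub>\<sigma> = (\<Prod>b\<in>B. if fst (n b) then 1 else q\<^sub>\<sigma>)"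
    define P\<^sub>\<tau> where "P\<^sub>\<tau> = (\<Prod>b\<in>B. if snd (n b) then 1 else q\<^sub>\<tau>)"
    \<comment> \<open>The \<sigma>-bonds of \<open>n\<close> are dual to the \<tau>-bonds of
      \<open>dual_config n\<close>, hence the exchange of the two cluster parameters.\<close>
    have "P\<^sub>\<sigma> * q\<^sub>\<sigma> ^ N\<^sub>\<tau> (dual_config n) ?V' * q\<^sub>\<sigma> ^ t = q\<^sub>\<sigma> ^ card ?V' * q\<^sub>\<sigma> ^ N\<^sub>\<sigma> n ?V"
      unfolding P\<^sub>\<sigma>_def N\<^sub>\<sigma>_def N\<^sub>\<tau>_def t_def
      using n by (intro cluster_number_dual_power[OF B]) (auto simp: configs_outside_def)
    then have \<sigma>: "P\<^sub>\<sigma> * q\<^sub>\<sigma> ^ N\<^sub>\<tau> (dual_config n) ?V' = q\<^sub>\<sigma> ^ card ?V' / q\<^sub>\<sigma> ^ t * q\<^sub>\<sigma> ^ N\<^sub>\<sigma> n ?V"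
      using q by (simp add: field_simps)
    have "P\<^sub>\<tau> * q\<^sub>\<tau> ^ N\<^sub>\<sigma> (dual_config n) ?V' * q\<^sub>\<tau> ^ t = q\<^sub>\<tau> ^ card ?V' * q\<^sub>\<tau> ^ N\<^sub>\<tau> n ?V"
      unfolding P\<^sub>\<tau>_def N\<^sub>\<sigma>_def N\<^sub>\<tau>_def t_def
      using n by (intro cluster_number_dual_power[OF B]) (auto simp: configs_outside_def)
    then have \<tau>: "P\<^sub>\<tau> * q\<^sub>\<tau> ^ N\<^sub>\<sigma> (dual_config n) ?V' = q\<^sub>\<tau> ^ card ?V' / q\<^sub>\<tau> ^ t * q\<^sub>\<tau> ^ N\<^sub>\<tau> n ?V"
      using q by (simp add: field_simps)
    have "rc_weight (dual_bond ` B) ?V' a'\<^sub>0 a'\<^sub>\<sigma> a'\<^sub>\<tau> a'\<^sub>\<sigma>\<^sub>\<tau> q\<^sub>\<tau> q\<^sub>\<sigma> (dual_config n)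
        = (\<Prod>b\<in>B. C' b) * bond_weight B a\<^sub>0 a\<^sub>\<sigma> a\<^sub>\<tau> a\<^sub>\<sigma>\<^sub>\<tau> n
          * (P\<^sub>\<sigma> * q\<^sub>\<sigma> ^ N\<^sub>\<tau> (dual_config n) ?V') * (P\<^sub>\<tau> * q\<^sub>\<tau> ^ N\<^sub>\<sigma> (dual_config n) ?V')"
      by (simp add: rc_weight_def bond_weight_dual_config[where C' = C' and q\<^sub>\<sigma> = q\<^sub>\<sigma> and q\<^sub>\<tau> = q\<^sub>\<tau> and a'\<^sub>0 = a'\<^sub>0
            and a'\<^sub>\<sigma> = a'\<^sub>\<sigma> and a'\<^sub>\<tau> = a'\<^sub>\<tau> and a'\<^sub>\<sigma>\<^sub>\<tau> = a'\<^sub>\<sigma>\<^sub>\<tau>, OF a'] P\<^sub>\<sigma>_def P\<^sub>\<tau>_def)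
    also have "\<dots> = K * rc_weight B ?V a\<^sub>0 a\<^sub>\<sigma> a\<^sub>\<tau> a\<^sub>\<sigma>\<^sub>\<tau> q\<^sub>\<sigma> q\<^sub>\<tau> n"
      unfolding \<sigma> \<tau> K_def rc_weight_def by (simp only: mult_ac)
    finally show ?thesis .
  qed
  ultimately show ?thesis by (rule that)
qed

theorem proposition3p2:
  fixes \<Lambda> :: "site set"
    and q\<^sub>\<sigma> q\<^sub>\<tau> :: real
    and a\<^sub>0 a\<^sub>\<sigma> a\<^sub>\<tau> a\<^sub>\<sigma>\<^sub>\<tau> C' a'\<^sub>0 a'\<^sub>\<sigma> a'\<^sub>\<tau> a'\<^sub>\<sigma>\<^sub>\<tau> :: "bond \<Rightarrow> real"
    and q'\<^sub>\<sigma> q'\<^sub>\<tau> :: real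
    and f :: "config \<Rightarrow> real"
  assumes "finite \<Lambda>"
    and "simply_connected_sites \<Lambda>"
    and "q\<^sub>\<sigma> > 0" and "q\<^sub>\<tau> > 0"
    and "\<And>b. a\<^sub>0 b \<ge> 0" and "\<And>b. a\<^sub>\<sigma> b \<ge> 0" and "\<And>b. a\<^sub>\<tau> b \<ge> 0" and "\<And>b. a\<^sub>\<sigma>\<^sub>\<tau> b \<ge> 0"
    and "\<And>b. a\<^sub>0 b + a\<^sub>\<sigma> b + a\<^sub>\<tau> b + a\<^sub>\<sigma>\<^sub>\<tau> b = 1"
    and "\<And>b. C' b = 1 / (a\<^sub>\<sigma>\<^sub>\<tau> b + q\<^sub>\<tau> * a\<^sub>\<sigma> b + q\<^sub>\<sigma> * a\<^sub>\<tau> b + q\<^sub>\<sigma> * q\<^sub>\<tau> * a\<^sub>0 b)"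
    and "\<And>b. a'\<^sub>0 (dual_bond b) = C' b * a\<^sub>\<sigma>\<^sub>\<tau> b"
    and "\<And>b. a'\<^sub>\<sigma> (dual_bond b) = q\<^sub>\<tau> * C' b * a\<^sub>\<sigma> b"
    and "\<And>b. a'\<^sub>\<tau> (dual_bond b) = q\<^sub>\<sigma> * C' b * a\<^sub>\<tau> b"
    and "\<And>b. a'\<^sub>\<sigma>\<^sub>\<tau> (dual_bond b) = q\<^sub>\<sigma> * q\<^sub>\<tau> * C' b * a\<^sub>0 b"
    and "q'\<^sub>\<sigma> = q\<^sub>\<tau>" and "q'\<^sub>\<tau> = q\<^sub>\<sigma>"
  shows "(\<integral>n. f n \<partial>(nu_plus \<Lambda> a\<^sub>0 a\<^sub>\<sigma> a\<^sub>\<tau> a\<^sub>\<sigma>\<^sub>\<tau> q\<^sub>\<sigma> q\<^sub>\<tau>))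
       = (\<integral>m. f (inv dual_config m) \<partial>(nu_free_star \<Lambda> a'\<^sub>0 a'\<^sub>\<sigma> a'\<^sub>\<tau> a'\<^sub>\<sigma>\<^sub>\<tau> q'\<^sub>\<sigma> q'\<^sub>\<tau>))"
proof -
  let ?B = "bonds_plus \<Lambda>"
  let ?V = "bond_sites ?B" and ?V' = "bond_sites (dual_bond ` ?B)"
  let ?A = "configs_outside (True, True) ?B"
  let ?w = "rc_weight ?B ?V a\<^sub>0 a\<^sub>\<sigma> a\<^sub>\<tau> a\<^sub>\<sigma>\<^sub>\<tau> q\<^sub>\<sigma> q\<^sub>\<tau>"
  let ?w' = "rc_weight (dual_bond ` ?B) ?V' a'\<^sub>0 a'\<^sub>\<sigma> a'\<^sub>\<tau> a'\<^sub>\<sigma>\<^sub>\<tau> q\<^sub>\<tau> q\<^sub>\<sigma>"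
  note q = assms(3,4) and a = assms(5-9) and C' = assms(10) and a' = assms(11-14)
  have B: "finite ?B" using assms(1) by (rule finite_bonds_plus)
  have "a\<^sub>\<sigma>\<^sub>\<tau> b + q\<^sub>\<tau> * a\<^sub>\<sigma> b + q\<^sub>\<sigma> * a\<^sub>\<tau> b + q\<^sub>\<sigma> * q\<^sub>\<tau> * a\<^sub>0 b > 0" for b
  proof -
    have "a\<^sub>\<sigma>\<^sub>\<tau> b \<ge> 0" "q\<^sub>\<tau> * a\<^sub>\<sigma> b \<ge> 0" "q\<^sub>\<sigma> * a\<^sub>\<tau> b \<ge> 0" "q\<^sub>\<sigma> * q\<^sub>\<tau> * a\<^sub>0 b \<ge> 0"
      using q a by (simp_all add: less_imp_le)
    \<comment> \<open>The four weights sum to 1, so they cannot all vanish, and the factors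
      \<open>q\<^sub>\<sigma>\<close>, \<open>q\<^sub>\<tau>\<close> are nonzero.\<close>
    moreover have "a\<^sub>\<sigma>\<^sub>\<tau> b \<noteq> 0 \<or> q\<^sub>\<tau> * a\<^sub>\<sigma> b \<noteq> 0 \<or> q\<^sub>\<sigma> * a\<^sub>\<tau> b \<noteq> 0 \<or> q\<^sub>\<sigma> * q\<^sub>\<tau> * a\<^sub>0 b \<noteq> 0"
      using q a(5)[of b] by auto
    ultimately show ?thesis by linarith
  qed
  then have C'_pos: "C' b > 0" for b by (simp add: C')
  then obtain K where K: "K > 0" "\<And>n. n \<in> ?A \<Longrightarrow> ?w' (dual_config n) = K * ?w n"
    using rc_weight_dual_config[where C' = C' and q\<^sub>\<sigma> = q\<^sub>\<sigma> and q\<^sub>\<tau> = q\<^sub>\<tau> and a'\<^sub>0 = a'\<^sub>0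
            and a'\<^sub>\<sigma> = a'\<^sub>\<sigma> and a'\<^sub>\<tau> = a'\<^sub>\<tau> and a'\<^sub>\<sigma>\<^sub>\<tau> = a'\<^sub>\<sigma>\<^sub>\<tau>, OF B q _ a'] by blast
  have w: "?w n \<ge> 0" for n
    using q a by (intro rc_weight_nonneg) (auto intro: less_imp_le)
  have nonneg': "a'\<^sub>0 e \<ge> 0 \<and> a'\<^sub>\<sigma> e \<ge> 0 \<and> a'\<^sub>\<tau> e \<ge> 0 \<and> a'\<^sub>\<sigma>\<^sub>\<tau> e \<ge> 0" for e
  proof -
    obtain b where "e = dual_bond b" using bij_dual_bond by (metis bij_pointE)
    then show ?thesis using q a C'_pos[of b] by (simp add: a' less_imp_le)
  qed
  have w': "?w' m \<ge> 0" for m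
    using q nonneg' by (intro rc_weight_nonneg) (auto intro: less_imp_le)
  have inj: "inj dual_config" using bij_dual_config by (rule bij_is_inj)
  \<comment> \<open>Stated for all \<open>g\<close>, since it serves both the numerator and, with
    \<open>g\<close> equal to 1, the partition function; \<open>K\<close> then cancels in the
    quotient.\<close>
  have dual_sum: "(\<Sum>m\<in>configs_outside (False, False) (dual_bond ` ?B). ?w' m * g m)
      = K * (\<Sum>n\<in>?A. ?w n * g (dual_config n))" for g
  proof -
    have "(\<Sum>m\<in>configs_outside (False, False) (dual_bond ` ?B). ?w' m * g m)
        = (\<Sum>n\<in>?A. ?w' (dual_config n) * g (dual_config n))"
      using inj by (simp add: sum.reindex inj_on_subset flip: dual_config_image_configs_outside)
    also have "\<dots> = K * (\<Sum>n\<in>?A. ?w n * g (dual_config n))"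
      by (simp add: K(2) sum_distrib_left mult.assoc)
    finally show ?thesis .
  qed
  have "(\<integral>m. f (inv dual_config m) \<partial>(nu_free_star \<Lambda> a'\<^sub>0 a'\<^sub>\<sigma> a'\<^sub>\<tau> a'\<^sub>\<sigma>\<^sub>\<tau> q'\<^sub>\<sigma> q'\<^sub>\<tau>))
      = (K * (\<Sum>n\<in>?A. ?w n * f n)) / (K * (\<Sum>n\<in>?A. ?w n))"
    using dual_sum[of "\<lambda>m. f (inv dual_config m)"] dual_sum[of "\<lambda>_. 1"] B w'
    by (simp add: nu_free_star_def bonds_star_eq assms(15,16) integral_rc_measure inv_f_f[OF inj])
  also have "\<dots> = (\<integral>n. f n \<partial>(nu_plus \<Lambda> a\<^sub>0 a\<^sub>\<sigma> a\<^sub>\<tau> a\<^sub>\<sigma>\<^sub>\<tau> q\<^sub>\<sigma> q\<^sub>\<tau>))"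
    using K(1) B w by (simp add: nu_plus_def integral_rc_measure)
  finally show ?thesis by simp
qed

end
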